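(* Let $0<\mu\le1$, $L\ge0$, $0\le\delta<1$ and $\chi_1>0$. Let $X^\star,S^\star\in\mathcal S^n_+$ satisfy $X^\star S^\star=0$ and $\chi_1^{-1}I\preceq X^\star+S^\star\preceq I$, and let $r=\operatorname{rank}(X^\star)$ with $1\le r<n$. Let $X,S\in\mathcal S^n_{++}$ satisfy $$\left\|\tfrac1\mu X^{1/2}SX^{1/2}-I\right\|\le\delta,\qquad\|X-X^\star\|\le L\mu,\qquad\|S-S^\star\|\le L,$$ and let $W=X^{1/2}(X^{1/2}SX^{1/2})^{-1/2}X^{1/2}$. Then the eigenvalues of $W$ satisfy $$\frac{C_1}{\sqrt\mu}\ge\lambda_1(W)\ge\lambda_r(W)\ge\frac{1}{C_2\sqrt\mu},\qquad C_1\sqrt\mu\ge\lambda_{r+1}(W)\ge\lambda_n(W)\ge\frac{\sqrt\mu}{C_1},$$ where $C_1=\frac{1+L}{1-\delta}$ and $C_2=4\chi_1+\frac{2L^2\chi_1}{1-\delta}$.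
   Context: $\mathcal S^n_+$ and $\mathcal S^n_{++}$ are the real symmetric positive semidefinite and positive definite $n\times n$ matrices; $\lambda_1(W)\ge\dots\ge\lambda_n(W)$ are the ordered eigenvalues; $\|\cdot\|$ is the spectral norm; $A\succeq B$ means $A-B$ is positive semidefinite. *)

theory Defs
  imports
    "HOL-Analysis.Analysis"
    "HOL-Computational_Algebra.Polynomial"
begin

definition psd :: "real^'n^'n \<Rightarrow> bool" where
  "psd A \<longleftrightarrow> transpose A = A \<and> (\<forall>x. 0 \<le> x \<bullet> (A *v x))"

definition pd :: "real^'n^'n \<Rightarrow> bool" where
  "pd A \<longleftrightarrow> transpose A = A \<and> (\<forall>x. x \<noteq> 0 \<longrightarrow> 0 < x \<bullet> (A *v x))"

definition loewner_le :: "real^'n^'n \<Rightarrow> real^'n^'n \<Rightarrow> bool"  (infix "\<preceq>" 50) where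
  "B \<preceq> A \<longleftrightarrow> psd (A - B)"

(* The norm of real^'n^'n provided by the library is the Frobenius norm,
   hence the explicit operator norm. *)
definition spectral_norm :: "real^'n^'n \<Rightarrow> real" where
  "spectral_norm A = onorm (\<lambda>x. A *v x)"

(* Meaningful for positive semidefinite A, where exactly one such B exists. *)
definition mat_sqrt :: "real^'n^'n \<Rightarrow> real^'n^'n" where
  "mat_sqrt A = (THE B. psd B \<and> B ** B = A)"

definition charpoly :: "real^'n^'n \<Rightarrow> real poly" where
  "charpoly A = det (mat [:0, 1:] - map_matrix (\<lambda>a. [:a:]) A)"

(* The k-th largest eigenvalue, counted with algebraic multiplicity, for
   1 \<le> k \<le> CARD('n) (indices start at 1). Meaningful for symmetric A, whose
   characteristic polynomial has CARD('n) real roots. *)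
definition eigval :: "nat \<Rightarrow> real^'n^'n \<Rightarrow> real" where
  "eigval k A = rev (sorted_list_of_multiset (proots (charpoly A))) ! (k - 1)"

end

theory Submission
  imports Defs
begin

text \<open>
  The scaling point \<open>W\<close> satisfies \<open>W S W = X\<close>. Put \<open>a\<^sup>2 = (1 - \<delta>) \<mu>\<close> and \<open>b\<^sup>2 = (1 + \<delta>) \<mu>\<close>. The centrality
  hypothesis says \<open>a\<^sup>2 I \<preceq> X\<^sup>1\<^sup>/\<^sup>2 S X\<^sup>1\<^sup>/\<^sup>2 \<preceq> b\<^sup>2 I\<close>, and it makes \<open>W\<close> comparable with \<open>X\<close> and \<open>W\<^sup>-\<^sup>1\<close> with \<open>S\<close>:
  \<open>X / b \<preceq> W \<preceq> X / a\<close> and \<open>W\<^sup>-\<^sup>1 \<preceq> S / a\<close>. This is the lemma \<open>scaling_point\<close>; the last comparison appears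
  there as the two statements \<open>a W \<preceq> X\<close> and \<open>X = W S W\<close>.

  Since \<open>X\<close> and \<open>S\<close> are close to \<open>X_star\<close> and \<open>S_star\<close>, which are bounded by \<open>I\<close>, the eigenvalue bounds follow
  by testing these forms on subspaces (\<open>eigval_le_of_subspace\<close>, \<open>eigval_ge_of_subspace\<close>, and
  \<open>eigval_ge_of_range_subspace\<close> for tests through \<open>W\<^sup>-\<^sup>1\<close>):

  \<^item> On the whole space \<open>X \<preceq> (1 + L) I\<close> bounds the largest eigenvalue of \<open>W\<close> from above, and \<open>S \<preceq> (1 + L) I\<close> bounds
    the smallest one from below.

  \<^item> On the kernel of \<open>X_star\<close>, of dimension \<open>n - r\<close>, the form of \<open>X\<close> is at most \<open>L \<mu>\<close>. This bounds the
    eigenvalue at position \<open>r + 1\<close> from above.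

  \<^item> On the range of \<open>X_star\<close>, of dimension \<open>r\<close>, the matrix \<open>S_star\<close> vanishes, so \<open>X_star\<close> is at least
    \<open>1 / chi1\<close> and the form of \<open>S\<close> is at most \<open>L\<close>. If \<open>L \<mu> \<le> 1 / (2 chi1)\<close>, then \<open>X\<close> is at least
    \<open>1 / (2 chi1)\<close> there, and \<open>X / b \<preceq> W\<close> bounds the eigenvalue at position \<open>r\<close> from below. Otherwise \<open>\<mu>\<close>
    is so large that \<open>W\<^sup>-\<^sup>1 \<preceq> S / a\<close> suffices. The two terms of \<open>C2\<close> stem from these two cases.

  The min-max bounds and the existence and uniqueness of square roots rest on the spectral theorem for real
  symmetric matrices, which links the roots of the characteristic polynomial to an orthonormal eigenbasis
  (\<open>symmetric_has_eigenbasis\<close>, \<open>eigval_enumeration\<close>).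
\<close>

section \<open>Symmetric matrices as quadratic forms\<close>

lemma symmetric_inner:
  fixes A :: "real^'n^'n"
  assumes "transpose A = A"
  shows "x \<bullet> (A *v y) = (A *v x) \<bullet> y"
  by (metis assms dot_lmul_matrix vector_transpose_matrix)

lemma symmetricI:
  fixes A :: "real^'n^'n"
  assumes "\<And>x y. x \<bullet> (A *v y) = (A *v x) \<bullet> y"
  shows "transpose A = A"
proof -
  have "(transpose A *v x) \<bullet> y = (A *v x) \<bullet> y" for x y
    by (metis assms dot_lmul_matrix vector_transpose_matrix transpose_transpose)
  then have "transpose A *v x = A *v x" for x
    using vector_eq_rdot by blast
  then show ?thesis
    by (simp add: matrix_eq)
qed

lemma symmetric_quadratic_add:
  fixes A :: "real^'n^'n"
  assumes "transpose A = A"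
  shows "(x + s *\<^sub>R y) \<bullet> (A *v (x + s *\<^sub>R y)) =
    x \<bullet> (A *v x) + 2 * s * (x \<bullet> (A *v y)) + s\<^sup>2 * (y \<bullet> (A *v y))"
proof -
  have "y \<bullet> (A *v x) = x \<bullet> (A *v y)"
    using symmetric_inner[OF assms] by (metis inner_commute)
  then show ?thesis
    by (simp add: matrix_vector_right_distrib matrix_vector_mult_scaleR inner_add_left
        inner_add_right power2_eq_square algebra_simps)
qed

text \<open>
  The quadratic polynomial \<open>s \<mapsto> (x + s y) \<bullet> A (x + s y)\<close> is nonnegative, so its discriminant is not
  positive. Nonnegativity is asked on a subspace only, because the Rayleigh quotient is maximised on
  invariant subspaces below.
\<close>

lemma semidefinite_Cauchy_Schwarz:
  fixes A :: "real^'n^'n"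
  assumes sym: "transpose A = A" and V: "subspace V"
    and nonneg: "\<And>z. z \<in> V \<Longrightarrow> 0 \<le> z \<bullet> (A *v z)"
    and x: "x \<in> V" and y: "y \<in> V"
  shows "(x \<bullet> (A *v y))\<^sup>2 \<le> (x \<bullet> (A *v x)) * (y \<bullet> (A *v y))"
proof -
  define p b q where "p = x \<bullet> (A *v x)" and "b = x \<bullet> (A *v y)" and "q = y \<bullet> (A *v y)"
  have poly: "0 \<le> p + 2 * s * b + s\<^sup>2 * q" for s
  proof -
    have "x + s *\<^sub>R y \<in> V"
      using V x y by (simp add: subspace_add subspace_scale)
    from nonneg[OF this] show ?thesis
      by (simp add: symmetric_quadratic_add[OF sym] p_def b_def q_def)
  qed
  have "0 \<le> q"
    using nonneg[OF y] by (simp add: q_def)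
  have "b\<^sup>2 \<le> p * q"
  proof (cases "q = 0")
    case False
    with \<open>0 \<le> q\<close> have "0 < q" by simp
    have "0 \<le> p + 2 * (- b / q) * b + (- b / q)\<^sup>2 * q" by (rule poly)
    also have "\<dots> = p - b\<^sup>2 / q"
      using \<open>0 < q\<close> by (simp add: power2_eq_square field_simps)
    finally show ?thesis
      using \<open>0 < q\<close> by (simp add: field_simps)
  next
    case True
    have "b = 0"
    proof (rule ccontr)
      assume "b \<noteq> 0"
      have "0 \<le> p + 2 * (- (p + 1) / (2 * b)) * b"
        using poly[of "- (p + 1) / (2 * b)"] True by simp
      also have "\<dots> = -1"
        using \<open>b \<noteq> 0\<close> by (simp add: field_simps)
      finally show False by simp
    qed
    then show ?thesis using True by simp
  qed
  then show ?thesis by (simp add: p_def b_def q_def)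
qed

lemma pd_imp_psd: "pd A \<Longrightarrow> psd A"
  unfolding pd_def psd_def by (metis inner_zero_left less_eq_real_def)

text \<open>
  Together with the next lemma this turns bounds on \<open>R\<^sup>2\<close>, that is on the eigenvalues of \<open>R\<close>, into the
  comparisons \<open>a R \<preceq> R\<^sup>2 \<preceq> b R\<close>, without diagonalising \<open>R\<close>. The lower comparison is the
  Cauchy-Schwarz inequality for the inner product.
\<close>

lemma form_le_square:
  fixes R :: "real^'n^'n"
  assumes "0 \<le> a" and lower: "a\<^sup>2 * (z \<bullet> z) \<le> (R *v z) \<bullet> (R *v z)"
  shows "a * (z \<bullet> (R *v z)) \<le> (R *v z) \<bullet> (R *v z)"
proof -
  have "(a * norm z)\<^sup>2 \<le> (norm (R *v z))\<^sup>2"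
    using lower by (simp add: power_mult_distrib power2_norm_eq_inner)
  then have "a * norm z \<le> norm (R *v z)"
    by (rule power2_le_imp_le) simp
  then have "(a * norm z) * norm (R *v z) \<le> norm (R *v z) * norm (R *v z)"
    by (intro mult_right_mono) auto
  moreover have "a * (z \<bullet> (R *v z)) \<le> a * (norm z * norm (R *v z))"
    using \<open>0 \<le> a\<close> by (intro mult_left_mono norm_cauchy_schwarz)
  ultimately show ?thesis
    by (simp add: mult.assoc power2_norm_eq_inner[symmetric] power2_eq_square)
qed

text \<open>
  The upper comparison is the Cauchy-Schwarz inequality for the form of \<open>R\<close>, applied to \<open>z\<close> and
  \<open>y = R z\<close>: it gives \<open>(y \<bullet> y)\<^sup>2 \<le> (z \<bullet> R z) (y \<bullet> R y)\<close>, and the bound on \<open>R\<^sup>2\<close> at \<open>y\<close> gives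
  \<open>y \<bullet> R y \<le> b (y \<bullet> y)\<close>.
\<close>

lemma square_le_psd_form:
  fixes R :: "real^'n^'n"
  assumes R: "psd R" and "0 \<le> b"
    and upper: "\<And>z. (R *v z) \<bullet> (R *v z) \<le> b\<^sup>2 * (z \<bullet> z)"
  shows "(R *v z) \<bullet> (R *v z) \<le> b * (z \<bullet> (R *v z))"
proof (cases "R *v z = 0")
  case False
  have sym: "transpose R = R" and nonneg: "\<And>x. 0 \<le> x \<bullet> (R *v x)"
    using R by (auto simp: psd_def)
  let ?y = "R *v z"
  have "?y \<bullet> (R *v ?y) \<le> norm ?y * norm (R *v ?y)"
    by (rule norm_cauchy_schwarz)
  also have "\<dots> \<le> norm ?y * (b * norm ?y)"
  proof (rule mult_left_mono, rule power2_le_imp_le)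
    show "(norm (R *v ?y))\<^sup>2 \<le> (b * norm ?y)\<^sup>2"
      using upper[of ?y] by (simp add: power_mult_distrib power2_norm_eq_inner)
  qed (use \<open>0 \<le> b\<close> in simp_all)
  finally have yRy: "?y \<bullet> (R *v ?y) \<le> b * (?y \<bullet> ?y)"
    by (simp add: power2_norm_eq_inner[symmetric] power2_eq_square mult_ac)
  have "(?y \<bullet> ?y)\<^sup>2 = (z \<bullet> (R *v ?y))\<^sup>2"
    by (simp add: symmetric_inner[OF sym])
  also have "\<dots> \<le> (z \<bullet> ?y) * (?y \<bullet> (R *v ?y))"
    by (rule semidefinite_Cauchy_Schwarz[OF sym subspace_UNIV]) (auto simp: nonneg)
  also have "\<dots> \<le> (z \<bullet> ?y) * (b * (?y \<bullet> ?y))"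
    using yRy nonneg by (intro mult_left_mono)
  finally show ?thesis
    using False by (simp add: power2_eq_square mult_ac)
qed simp

lemma spectral_norm_form:
  fixes A :: "real^'n^'n"
  assumes "spectral_norm A \<le> c"
  shows "\<bar>x \<bullet> (A *v x)\<bar> \<le> c * (x \<bullet> x)"
proof -
  have "norm (A *v x) \<le> onorm ((*v) A) * norm x"
    by (rule onorm) simp
  also have "\<dots> \<le> c * norm x"
    using assms by (intro mult_right_mono) (simp_all add: spectral_norm_def)
  finally have "norm x * norm (A *v x) \<le> norm x * (c * norm x)"
    by (intro mult_left_mono) auto
  then show ?thesis
    using Cauchy_Schwarz_ineq2[of x "A *v x"]
    by (simp add: power2_norm_eq_inner[symmetric] power2_eq_square mult_ac)
qed

text \<open>
  The kernel of a symmetric matrix is the orthogonal complement of its range.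
\<close>

lemma dim_kernel_symmetric:
  fixes A :: "real^'n^'n"
  assumes "transpose A = A"
  shows "dim {x. A *v x = 0} + rank A = CARD('n)"
proof -
  have "{x. A *v x = 0} = {y \<in> UNIV. \<forall>x\<in>range ((*v) A). orthogonal x y}"
  proof -
    have "A *v y = 0 \<longleftrightarrow> (\<forall>x. (A *v x) \<bullet> y = 0)" for y
      by (metis symmetric_inner[OF assms] inner_zero_right inner_eq_zero_iff)
    then show ?thesis
      by (auto simp: orthogonal_def)
  qed
  moreover have "dim {y \<in> UNIV. \<forall>x\<in>range ((*v) A). orthogonal x y} + dim (range ((*v) A))
      = dim (UNIV :: (real^'n) set)"
    by (intro dim_subspace_orthogonal_to_vectors)
      (auto intro!: linear_subspace_image subspace_UNIV)
  ultimately show ?thesis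
    by (simp add: rank_dim_range)
qed

section \<open>The spectral theorem\<close>

text \<open>
  Let \<open>u\<close> maximise \<open>x \<bullet> A x\<close> on the unit sphere of \<open>V\<close>, with maximum \<open>t\<close>. Then \<open>B = t I - A\<close> is
  positive semidefinite on \<open>V\<close> and its form vanishes at \<open>u\<close>. By Cauchy-Schwarz \<open>u \<bullet> B y = 0\<close> for all
  \<open>y\<close> in \<open>V\<close>; the choice \<open>y = B u\<close>, which lies in \<open>V\<close> by invariance, gives \<open>B u = 0\<close>.
\<close>

lemma Rayleigh_maximizer_is_eigenvector:
  fixes A :: "real^'n^'n"
  assumes sym: "transpose A = A" and V: "subspace V"
    and inv: "\<And>x. x \<in> V \<Longrightarrow> A *v x \<in> V" and ne: "V \<noteq> {0}"
  shows "\<exists>u\<in>V. norm u = 1 \<and> (\<exists>t. A *v u = t *\<^sub>R u)"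
proof -
  let ?K = "V \<inter> sphere 0 1"
  have "compact ?K"
    using V by (simp add: closed_Int_compact closed_subspace)
  moreover have "?K \<noteq> {}"
  proof -
    obtain w where "w \<in> V" "w \<noteq> 0"
      using ne subspace_0[OF V] by auto
    then have "(1 / norm w) *\<^sub>R w \<in> ?K"
      using V by (simp add: subspace_scale)
    then show ?thesis by blast
  qed
  moreover have "continuous_on ?K (\<lambda>x. x \<bullet> (A *v x))"
    by (intro continuous_intros linear_continuous_on) (simp add: linear_conv_bounded_linear[symmetric])
  ultimately obtain u where u: "u \<in> ?K" and max: "\<And>y. y \<in> ?K \<Longrightarrow> y \<bullet> (A *v y) \<le> u \<bullet> (A *v u)"
    using continuous_attains_sup[of ?K "\<lambda>x. x \<bullet> (A *v x)"] by blast
  define t where "t = u \<bullet> (A *v u)"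
  define B where "B = t *\<^sub>R mat 1 - A"
  have Bv: "B *v x = t *\<^sub>R x - A *v x" for x
    by (simp add: B_def matrix_vector_mult_diff_rdistrib scaleR_matrix_vector_assoc[symmetric])
  have symB: "transpose B = B"
    using sym by (auto simp: B_def transpose_def mat_def vec_eq_iff)
  have nonneg: "0 \<le> x \<bullet> (B *v x)" if "x \<in> V" for x
  proof (cases "x = 0")
    case False
    define y where "y = (1 / norm x) *\<^sub>R x"
    have "y \<in> ?K"
      using False that V by (simp add: y_def subspace_scale)
    have "x \<bullet> (A *v x) = (norm x)\<^sup>2 * (y \<bullet> (A *v y))"
      using False by (simp add: y_def matrix_vector_mult_scaleR power2_eq_square)
    also have "\<dots> \<le> (norm x)\<^sup>2 * t"
      using max[OF \<open>y \<in> ?K\<close>] by (simp add: t_def mult_left_mono)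
    finally show ?thesis
      by (simp add: Bv inner_diff_right power2_norm_eq_inner mult.commute)
  qed simp
  have uu: "u \<bullet> u = 1" and uV: "u \<in> V"
    using u by (auto simp: norm_eq_1)
  have "u \<bullet> (B *v u) = 0"
    by (simp add: Bv inner_diff_right uu t_def)
  moreover have BuV: "B *v u \<in> V"
    using uV V inv by (simp add: Bv subspace_diff subspace_scale)
  ultimately have "(u \<bullet> (B *v (B *v u)))\<^sup>2 \<le> 0"
    using semidefinite_Cauchy_Schwarz[OF symB V nonneg uV BuV] by simp
  then have "(B *v u) \<bullet> (B *v u) = 0"
    using symmetric_inner[OF symB] by simp
  then have "A *v u = t *\<^sub>R u"
    by (simp add: Bv)
  then show ?thesis
    using uV u by auto
qed

text \<open>
  Induction on the dimension: the vectors of \<open>V\<close> orthogonal to an eigenvector again form an invariant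
  subspace, by symmetry.
\<close>

lemma invariant_subspace_eigenbasis:
  fixes A :: "real^'n^'n"
  assumes sym: "transpose A = A" and "subspace V" and "\<And>x. x \<in> V \<Longrightarrow> A *v x \<in> V"
  shows "\<exists>B\<subseteq>V. finite B \<and> card B = dim V \<and> pairwise orthogonal B \<and>
    (\<forall>u\<in>B. norm u = 1 \<and> (\<exists>t. A *v u = t *\<^sub>R u))"
  using assms(2,3)
proof (induction "dim V" arbitrary: V)
  case 0
  then show ?case by (intro exI[of _ "{}"]) auto
next
  case (Suc k)
  note V = \<open>subspace V\<close>
  have "V \<noteq> {0}" using Suc.hyps(2) by auto
  then obtain u t where u: "u \<in> V" "norm u = 1" "A *v u = t *\<^sub>R u"
    using Rayleigh_maximizer_is_eigenvector[OF sym V Suc.prems(2)] by blast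
  define V' where "V' = {y \<in> V. \<forall>x\<in>span {u}. orthogonal x y}"
  have V'_iff: "y \<in> V' \<longleftrightarrow> y \<in> V \<and> u \<bullet> y = 0" for y
    by (auto simp: V'_def orthogonal_def span_singleton)
  have "span {u} \<subseteq> V"
    using u V by (simp add: span_minimal)
  then have "dim V' + dim (span {u}) = dim V"
    unfolding V'_def by (intro dim_subspace_orthogonal_to_vectors V) auto
  moreover have "u \<noteq> 0" using u by auto
  ultimately have "k = dim V'"
    using Suc.hyps(2) by simp
  moreover have "subspace V'"
    using V by (auto simp: subspace_def V'_iff inner_add_right)
  moreover have "A *v x \<in> V'" if "x \<in> V'" for x
    using that Suc.prems(2) u(3) by (simp add: V'_iff symmetric_inner[OF sym])
  ultimately obtain B where B: "B \<subseteq> V'" "finite B" "card B = dim V'" "pairwise orthogonal B"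
    "\<forall>u\<in>B. norm u = 1 \<and> (\<exists>t. A *v u = t *\<^sub>R u)"
    using Suc.hyps(1)[of V'] by blast
  have "u \<notin> B"
    using B(1) u(2) by (auto simp: V'_iff norm_eq_1)
  show ?case
  proof (intro exI[of _ "insert u B"] conjI)
    show "insert u B \<subseteq> V" using B(1) u(1) by (auto simp: V'_iff)
    show "card (insert u B) = dim V"
      using B \<open>u \<notin> B\<close> \<open>k = dim V'\<close> Suc.hyps(2) by simp
    show "pairwise orthogonal (insert u B)"
      using B(1,4) by (auto simp: pairwise_insert V'_iff orthogonal_def inner_commute)
  qed (use B u in auto)
qed

text \<open>
  Indexing the basis by the type \<open>'n\<close> itself makes the family a full basis by counting, and makes the
  matrix with these columns square.
\<close>

definition eigenbasis :: "real^'n^'n \<Rightarrow> ('n \<Rightarrow> real^'n) \<Rightarrow> ('n \<Rightarrow> real) \<Rightarrow> bool" where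
  "eigenbasis A v d \<longleftrightarrow>
    (\<forall>i j. v i \<bullet> v j = (if i = j then 1 else 0)) \<and> (\<forall>i. A *v v i = d i *\<^sub>R v i)"

theorem symmetric_has_eigenbasis:
  fixes A :: "real^'n^'n"
  assumes "transpose A = A"
  obtains v d where "eigenbasis A v d"
proof -
  obtain B :: "(real^'n) set" where B: "finite B" "card B = CARD('n)" "pairwise orthogonal B"
    "\<And>u. u \<in> B \<Longrightarrow> norm u = 1" "\<And>u. u \<in> B \<Longrightarrow> \<exists>t. A *v u = t *\<^sub>R u"
    using invariant_subspace_eigenbasis[OF assms, of UNIV] by auto
  obtain v :: "'n \<Rightarrow> real^'n" where v: "bij_betw v UNIV B"
    using B(1,2) by (metis finite finite_same_card_bij)
  then have vB: "v i \<in> B" for i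
    by (auto simp: bij_betw_def)
  obtain d where d: "\<And>i. A *v v i = d i *\<^sub>R v i"
    using B(5)[OF vB] by metis
  have "v i \<bullet> v j = (if i = j then 1 else 0)" for i j
  proof (cases "i = j")
    case True
    then show ?thesis using B(4)[OF vB] by (simp add: norm_eq_1)
  next
    case False
    then have "v i \<noteq> v j" using v by (auto simp: bij_betw_def inj_def)
    then show ?thesis
      using B(3) vB False by (simp add: pairwise_def orthogonal_def)
  qed
  with d that show thesis
    unfolding eigenbasis_def by blast
qed

context
  fixes A :: "real^'n^'n" and v d
  assumes basis: "eigenbasis A v d"
begin

lemma eigenbasis_inner: "v i \<bullet> v j = (if i = j then 1 else 0)"
  and eigenbasis_mult: "A *v v i = d i *\<^sub>R v i"
  using basis by (auto simp: eigenbasis_def)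

lemma eigenbasis_independent: "independent (v ` K)" and eigenbasis_inj: "inj v"
proof -
  show "inj v"
    by (metis eigenbasis_inner injI zero_neq_one)
  have "v i \<noteq> 0" for i
    using eigenbasis_inner[of i i] by auto
  then show "independent (v ` K)"
    by (intro pairwise_orthogonal_independent)
      (auto simp: pairwise_def orthogonal_def eigenbasis_inner)
qed

lemma dim_eigenbasis_span: "dim (span (v ` K)) = card K"
  using eigenbasis_independent eigenbasis_inj
  by (simp add: dim_eq_card_independent card_image inj_on_subset)

lemma eigenbasis_expansion: "x = (\<Sum>i\<in>UNIV. (v i \<bullet> x) *\<^sub>R v i)"
proof -
  have "dim (range v) = DIM(real^'n)"
    using dim_eigenbasis_span[of UNIV] by simp
  then have "x \<in> span (range v)"
    using dim_eq_full[of "range v"] by simp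
  then show ?thesis
  proof (induction rule: span_induct_alt)
    case (step c b y)
    obtain j where "b = v j" using step by auto
    have eq: "c *\<^sub>R v j = (\<Sum>i\<in>UNIV. (v i \<bullet> (c *\<^sub>R v j)) *\<^sub>R v i)"
      by (simp add: eigenbasis_inner if_distrib[where f="\<lambda>t. _ * t"] if_distrib[where f="\<lambda>t. t *\<^sub>R _"] cong: if_cong)
    show ?case
      unfolding \<open>b = v j\<close> inner_add_right scaleR_add_left sum.distrib
      by (rule arg_cong2[where f="(+)", OF eq step.IH])
  qed simp
qed

lemma eigenbasis_form: "x \<bullet> (A *v y) = (\<Sum>i\<in>UNIV. d i * (v i \<bullet> x) * (v i \<bullet> y))"
proof -
  have "A *v y = A *v (\<Sum>i\<in>UNIV. (v i \<bullet> y) *\<^sub>R v i)"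
    by (subst eigenbasis_expansion[of y]) (rule refl)
  also have "\<dots> = (\<Sum>i\<in>UNIV. (v i \<bullet> y) *\<^sub>R d i *\<^sub>R v i)"
    by (simp add: linear_sum[OF matrix_vector_mul_linear] matrix_vector_mult_scaleR eigenbasis_mult)
  finally show ?thesis
    by (simp add: inner_sum_right mult_ac inner_commute)
qed

lemma eigenbasis_norm: "x \<bullet> x = (\<Sum>i\<in>UNIV. (v i \<bullet> x)\<^sup>2)"
proof -
  have "x \<bullet> x = x \<bullet> (\<Sum>i\<in>UNIV. (v i \<bullet> x) *\<^sub>R v i)"
    by (subst (2) eigenbasis_expansion) (rule refl)
  then show ?thesis
    by (simp add: inner_sum_right power2_eq_square inner_commute)
qed

lemma eigenbasis_span_coord:
  assumes "x \<in> span (v ` K)" and "i \<notin> K"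
  shows "v i \<bullet> x = 0"
  using assms(1)
  by (induction rule: span_induct_alt) (use assms(2) in \<open>auto simp: inner_add_right eigenbasis_inner split: if_splits\<close>)

lemma form_le_on_eigenspan:
  assumes "\<And>i. i \<in> K \<Longrightarrow> d i \<le> c" and "x \<in> span (v ` K)"
  shows "x \<bullet> (A *v x) \<le> c * (x \<bullet> x)"
proof -
  have "(\<Sum>i\<in>UNIV. d i * (v i \<bullet> x) * (v i \<bullet> x)) \<le> (\<Sum>i\<in>UNIV. c * (v i \<bullet> x)\<^sup>2)"
  proof (rule sum_mono)
    fix i show "d i * (v i \<bullet> x) * (v i \<bullet> x) \<le> c * (v i \<bullet> x)\<^sup>2"
      using assms eigenbasis_span_coord[of x K i]
      by (cases "i \<in> K") (simp_all add: power2_eq_square mult.assoc mult_right_mono)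
  qed
  then show ?thesis
    by (simp add: eigenbasis_form eigenbasis_norm sum_distrib_left)
qed

lemma form_ge_on_eigenspan:
  assumes "\<And>i. i \<in> K \<Longrightarrow> c \<le> d i" and "x \<in> span (v ` K)"
  shows "c * (x \<bullet> x) \<le> x \<bullet> (A *v x)"
proof -
  have "(\<Sum>i\<in>UNIV. c * (v i \<bullet> x)\<^sup>2) \<le> (\<Sum>i\<in>UNIV. d i * (v i \<bullet> x) * (v i \<bullet> x))"
  proof (rule sum_mono)
    fix i show "c * (v i \<bullet> x)\<^sup>2 \<le> d i * (v i \<bullet> x) * (v i \<bullet> x)"
      using assms eigenbasis_span_coord[of x K i]
      by (cases "i \<in> K") (simp_all add: power2_eq_square mult.assoc mult_right_mono)
  qed
  then show ?thesis
    by (simp add: eigenbasis_form eigenbasis_norm sum_distrib_left)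
qed

end

section \<open>Eigenvalues as ordered roots of the characteristic polynomial\<close>

lemma sum_const_poly: "(\<Sum>k\<in>S. [:f k:]) = [:\<Sum>k\<in>S. f k:]"
  by (induction S rule: infinite_finite_induct) auto

lemma map_matrix_const_poly_mult:
  fixes A B :: "real^'n^'n"
  shows "map_matrix (\<lambda>a. [:a:]) (A ** B) = map_matrix (\<lambda>a. [:a:]) A ** map_matrix (\<lambda>a. [:a:]) B"
  by (simp add: vec_eq_iff matrix_matrix_mult_def sum_const_poly mult.commute)

text \<open>
  Similarity is stated without an inverse, as \<open>A Q = Q D\<close>. Read over the polynomial ring it gives
  \<open>(x I - A) Q = Q (x I - D)\<close>, and \<open>det Q\<close>, being a unit, cancels from the determinants.
\<close>

lemma charpoly_similar:
  fixes A D Q :: "real^'n^'n"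
  assumes "invertible Q" and "A ** Q = Q ** D"
  shows "charpoly A = charpoly D"
proof -
  let ?P = "map_matrix (\<lambda>a::real. [:a:]) :: real^'n^'n \<Rightarrow> real poly^'n^'n"
  let ?X = "mat [:0, 1:] :: real poly^'n^'n"
  have distr: "(M - N) ** K = M ** K - N ** K" "K ** (M - N) = K ** M - K ** N"
    for M N K :: "real poly^'n^'n"
    by (simp_all add: vec_eq_iff matrix_matrix_mult_def algebra_simps sum_subtractf)
  have comm: "?X ** K = K ** ?X" for K
    by (simp add: vec_eq_iff matrix_matrix_mult_def mat_def mult_delta_left mult_delta_right)
  obtain Q' where "Q ** Q' = mat 1"
    using assms(1) by (auto simp: invertible_def)
  then have "?P Q ** ?P Q' = ?P (mat 1)"
    by (simp only: map_matrix_const_poly_mult[symmetric])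
  also have "\<dots> = mat 1"
    by (simp add: vec_eq_iff mat_def one_pCons)
  finally have "det (?P Q) * det (?P Q') = 1"
    by (metis det_I det_mul)
  then have "det (?P Q) \<noteq> 0" by auto
  have "(?X - ?P A) ** ?P Q = ?P Q ** (?X - ?P D)"
    by (simp add: distr comm map_matrix_const_poly_mult[symmetric] assms(2))
  then have "det (?X - ?P A) * det (?P Q) = det (?P Q) * det (?X - ?P D)"
    by (metis det_mul)
  then show ?thesis
    using \<open>det (?P Q) \<noteq> 0\<close> by (simp add: charpoly_def)
qed

lemma charpoly_diagonal:
  fixes d :: "'n::finite \<Rightarrow> real"
  shows "charpoly (\<chi> i j. if i = j then d i else 0) = (\<Prod>i\<in>UNIV. [:- d i, 1:])"
proof -
  have "charpoly (\<chi> i j. if i = j then d i else 0) =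
    (\<Prod>i\<in>UNIV. (mat [:0, 1:] - map_matrix (\<lambda>a. [:a:]) (\<chi> i j. if i = j then d i else 0)) $ i $ i)"
    unfolding charpoly_def by (rule det_diagonal) (simp add: mat_def)
  then show ?thesis
    by (simp add: mat_def)
qed

lemma proots_charpoly_eigenbasis:
  fixes A :: "real^'n^'n"
  assumes "eigenbasis A v d"
  shows "proots (charpoly A) = image_mset d (mset_set UNIV)"
proof -
  define Q :: "real^'n^'n" where "Q = (\<chi> a i. v i $ a)"
  define D :: "real^'n^'n" where "D = (\<chi> i j. if i = j then d i else 0)"
  have "transpose Q ** Q = mat 1"
    using eigenbasis_inner[OF assms]
    by (auto simp: vec_eq_iff matrix_matrix_mult_def transpose_def Q_def mat_def inner_vec_def)
  then have "invertible Q"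
    by (auto simp: invertible_left_inverse)
  moreover have "A ** Q = Q ** D"
  proof -
    have "(A ** Q) $ a $ i = (A *v v i) $ a" for a i
      by (simp add: matrix_matrix_mult_def matrix_vector_mult_def Q_def)
    moreover have "(Q ** D) $ a $ i = d i * v i $ a" for a i
      by (simp add: matrix_matrix_mult_def Q_def D_def mult_delta_right)
    ultimately show ?thesis
      by (simp add: vec_eq_iff eigenbasis_mult[OF assms])
  qed
  ultimately have "charpoly A = (\<Prod>i\<in>UNIV. [:- d i, 1:])"
    using charpoly_similar[of Q A D] by (simp add: D_def charpoly_diagonal)
  then have "proots (charpoly A) = (\<Sum>i\<in>UNIV. {#d i#})"
    by (simp add: proots_prod)
  also have "\<dots> = image_mset d (mset_set UNIV)"
    by (simp add: sum_unfold_sum_mset)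
  finally show ?thesis .
qed

text \<open>
  Sorting the index type by the eigenvalue \<open>d\<close> attaches an eigenvector to every position of the ordered
  list of eigenvalues, so that multiplicities need no separate treatment.
\<close>

lemma eigval_enumeration:
  fixes A :: "real^'n^'n"
  assumes "eigenbasis A v d"
  obtains e where "bij_betw e {1..CARD('n)} UNIV"
    and "\<And>k. k \<in> {1..CARD('n)} \<Longrightarrow> eigval k A = d (e k)"
    and "\<And>j k. 1 \<le> j \<Longrightarrow> j \<le> k \<Longrightarrow> k \<le> CARD('n) \<Longrightarrow> d (e k) \<le> d (e j)"
proof -
  obtain xs :: "'n list" where xs: "set xs = UNIV" "distinct xs"
    using finite_distinct_list[of "UNIV :: 'n set"] by auto
  define ys where "ys = rev (sort_key d xs)"
  define e where "e k = ys ! (k - 1)" for k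
  have ys: "set ys = UNIV" "distinct ys" and len: "length ys = CARD('n)"
    using xs distinct_card[of xs] by (auto simp: ys_def)
  have srt: "sorted (rev (map d ys))"
    by (simp add: ys_def rev_map[symmetric])
  have "mset_set UNIV = mset xs"
    using mset_set_set[OF xs(2)] xs(1) by simp
  then have "mset (rev (map d ys)) = image_mset d (mset_set UNIV)"
    by (simp add: ys_def)
  then have "sorted_list_of_multiset (proots (charpoly A)) = rev (map d ys)"
    using srt by (metis proots_charpoly_eigenbasis[OF assms] sorted_list_of_multiset_mset sorted_sort_id)
  then have eig: "eigval k A = map d ys ! (k - 1)" for k
    by (simp add: eigval_def)
  show thesis
  proof (rule that[of e])
    have "bij_betw (\<lambda>i. ys ! i) {..<CARD('n)} UNIV"
      using bij_betw_nth[OF ys(2)] ys(1) len by metis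
    moreover have "bij_betw (\<lambda>k. k - 1) {1..CARD('n)} {..<CARD('n)}"
      by (rule bij_betw_byWitness[where f' = Suc]) auto
    ultimately show "bij_betw e {1..CARD('n)} UNIV"
      using bij_betw_trans[of "\<lambda>k. k - 1"] unfolding e_def comp_def by blast
    show "eigval k A = d (e k)" if "k \<in> {1..CARD('n)}" for k
    proof -
      have "k - 1 < length ys"
        using that len by auto
      then show ?thesis by (simp add: eig e_def)
    qed
    show "d (e k) \<le> d (e j)" if "1 \<le> j" "j \<le> k" "k \<le> CARD('n)" for j k
    proof -
      have "k - 1 < length ys" "j - 1 < length ys" "j - 1 \<le> k - 1"
        using that len by auto
      then show ?thesis
        using sorted_rev_nth_mono[OF srt, of "j - 1" "k - 1"] by (simp add: e_def)
    qed
  qed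
qed

lemma eigval_antimono:
  fixes A :: "real^'n^'n"
  assumes "transpose A = A" and "1 \<le> j" and "j \<le> k" and "k \<le> CARD('n)"
  shows "eigval k A \<le> eigval j A"
proof -
  obtain v d where "eigenbasis A v d"
    using symmetric_has_eigenbasis[OF assms(1)] .
  then show "eigval k A \<le> eigval j A"
  proof (rule eigval_enumeration)
    fix e :: "nat \<Rightarrow> 'n"
    assume "\<And>k. k \<in> {1..CARD('n)} \<Longrightarrow> eigval k A = d (e k)"
      and "\<And>j k. 1 \<le> j \<Longrightarrow> j \<le> k \<Longrightarrow> k \<le> CARD('n) \<Longrightarrow> d (e k) \<le> d (e j)"
    then show ?thesis using assms(2-4) by simp
  qed
qed

lemma subspaces_meet:
  fixes U V :: "'a::euclidean_space set"
  assumes "subspace U" and "subspace V" and "DIM('a) < dim U + dim V"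
  shows "\<exists>x\<in>U \<inter> V. x \<noteq> 0"
proof (rule ccontr)
  assume "\<not> ?thesis"
  then have "U \<inter> V \<subseteq> {0}"
    by blast
  then have "dim (U \<inter> V) = 0"
    by simp
  moreover have "dim {x + y |x y. x \<in> U \<and> y \<in> V} \<le> DIM('a)"
    by (rule dim_subset_UNIV)
  ultimately show False
    using dim_sums_Int[OF assms(1,2)] assms(3) by linarith
qed

text \<open>
  This and the next lemma are the two halves of the Courant-Fischer principle. The eigenvectors of the
  positions \<open>k, \<dots>, n\<close> span a space of dimension \<open>n - k + 1\<close>, which meets \<open>U\<close> outside \<open>0\<close>; on it the form
  is at most \<open>eigval k A\<close> times the squared norm.
\<close>

lemma eigval_ge_of_subspace:
  fixes A :: "real^'n^'n"
  assumes sym: "transpose A = A" and U: "subspace U" and k: "1 \<le> k" "k \<le> dim U"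
    and ge: "\<And>x. x \<in> U \<Longrightarrow> c * (x \<bullet> x) \<le> x \<bullet> (A *v x)"
  shows "c \<le> eigval k A"
proof -
  obtain v d where basis: "eigenbasis A v d"
    using symmetric_has_eigenbasis[OF sym] .
  obtain e where e: "bij_betw e {1..CARD('n)} UNIV"
    "\<And>k. k \<in> {1..CARD('n)} \<Longrightarrow> eigval k A = d (e k)"
    "\<And>j k. 1 \<le> j \<Longrightarrow> j \<le> k \<Longrightarrow> k \<le> CARD('n) \<Longrightarrow> d (e k) \<le> d (e j)"
    using eigval_enumeration[OF basis] by blast
  have kn: "k \<le> CARD('n)"
    using k(2) dim_subset_UNIV[of U] by simp
  let ?K = "e ` {k..CARD('n)}"
  have "card ?K = CARD('n) - k + 1"
    using inj_on_subset[OF bij_betw_imp_inj_on[OF e(1)], of "{k..CARD('n)}"] k(1) kn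
    by (simp add: card_image)
  then have "DIM(real^'n) < dim U + dim (span (v ` ?K))"
    using k kn by (simp only: dim_eigenbasis_span[OF basis]) simp
  then obtain x where x: "x \<in> U" "x \<in> span (v ` ?K)" "x \<noteq> 0"
    using subspaces_meet[OF U subspace_span] by auto
  have d_le: "d i \<le> eigval k A" if "i \<in> ?K" for i
    using that e(3)[of k] e(2)[of k] k(1) kn by auto
  have "c * (x \<bullet> x) \<le> eigval k A * (x \<bullet> x)"
    using ge[OF x(1)] form_le_on_eigenspan[OF basis d_le x(2)] by linarith
  then show ?thesis
    using x(3) by (simp add: mult_le_cancel_right not_less)
qed

text \<open>
  Here \<open>U\<close> meets the span of the first \<open>k\<close> eigenvectors.
\<close>

lemma eigval_le_of_subspace:
  fixes A :: "real^'n^'n"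
  assumes sym: "transpose A = A" and U: "subspace U"
    and k: "1 \<le> k" "k \<le> CARD('n)" "CARD('n) < dim U + k"
    and le: "\<And>x. x \<in> U \<Longrightarrow> x \<bullet> (A *v x) \<le> c * (x \<bullet> x)"
  shows "eigval k A \<le> c"
proof -
  obtain v d where basis: "eigenbasis A v d"
    using symmetric_has_eigenbasis[OF sym] .
  obtain e where e: "bij_betw e {1..CARD('n)} UNIV"
    "\<And>k. k \<in> {1..CARD('n)} \<Longrightarrow> eigval k A = d (e k)"
    "\<And>j k. 1 \<le> j \<Longrightarrow> j \<le> k \<Longrightarrow> k \<le> CARD('n) \<Longrightarrow> d (e k) \<le> d (e j)"
    using eigval_enumeration[OF basis] by blast
  let ?K = "e ` {1..k}"
  have "card ?K = k"
    using inj_on_subset[OF bij_betw_imp_inj_on[OF e(1)], of "{1..k}"] k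
    by (simp add: card_image)
  then have "DIM(real^'n) < dim U + dim (span (v ` ?K))"
    using k by (simp only: dim_eigenbasis_span[OF basis]) simp
  then obtain x where x: "x \<in> U" "x \<in> span (v ` ?K)" "x \<noteq> 0"
    using subspaces_meet[OF U subspace_span] by auto
  have le_d: "eigval k A \<le> d i" if "i \<in> ?K" for i
    using that e(3)[of _ k] e(2)[of k] k(1,2) by auto
  have "eigval k A * (x \<bullet> x) \<le> c * (x \<bullet> x)"
    using le[OF x(1)] form_ge_on_eigenspan[OF basis le_d x(2)] by linarith
  then show ?thesis
    using x(3) by (simp add: mult_le_cancel_right not_less)
qed

section \<open>Square roots and inverses\<close>

text \<open>
  Let \<open>D = B - C\<close> have the unit eigenvector \<open>v\<close> with eigenvalue \<open>t\<close>. From \<open>0 = B\<^sup>2 - C\<^sup>2 = B D + D C\<close>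
  follows \<open>t (v \<bullet> B v + v \<bullet> C v) = 0\<close>. Both summands are nonnegative and their difference is \<open>t\<close>, so
  \<open>t = 0\<close>.
\<close>

lemma psd_square_inj:
  fixes B C :: "real^'n^'n"
  assumes B: "psd B" and C: "psd C" and eq: "B ** B = C ** C"
  shows "B = C"
proof -
  define D where "D = B - C"
  have Dx: "D *v x = B *v x - C *v x" for x
    by (simp add: D_def matrix_vector_mult_diff_rdistrib)
  have symB: "transpose B = B" and symC: "transpose C = C"
    and B0: "0 \<le> x \<bullet> (B *v x)" and C0: "0 \<le> x \<bullet> (C *v x)" for x
    using B C by (auto simp: psd_def)
  have symD: "transpose D = D"
    by (rule symmetricI)
      (simp add: Dx inner_diff_left inner_diff_right symmetric_inner[OF symB] symmetric_inner[OF symC])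
  obtain v d where basis: "eigenbasis D v d"
    using symmetric_has_eigenbasis[OF symD] .
  have "d i = 0" for i
  proof -
    let ?v = "v i"
    have Dv: "D *v ?v = d i *\<^sub>R ?v"
      by (rule eigenbasis_mult[OF basis])
    have "B *v (B *v ?v) = C *v (C *v ?v)"
      by (simp add: matrix_vector_mul_assoc eq)
    then have "B *v (D *v ?v) + D *v (C *v ?v) = 0"
      by (simp add: Dx matrix_vector_mult_diff_distrib)
    then have "?v \<bullet> (B *v (D *v ?v)) + ?v \<bullet> (D *v (C *v ?v)) = 0"
      by (metis inner_add_right inner_zero_right)
    then have "d i * (?v \<bullet> (B *v ?v) + ?v \<bullet> (C *v ?v)) = 0"
      by (simp add: symmetric_inner[OF symD] Dv matrix_vector_mult_scaleR distrib_left)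
    moreover have "d i = ?v \<bullet> (B *v ?v) - ?v \<bullet> (C *v ?v)"
      using arg_cong[OF Dv, of "\<lambda>y. ?v \<bullet> y"] eigenbasis_inner[OF basis, of i i]
      by (simp add: Dx inner_diff_right)
    ultimately show "d i = 0"
      using B0[of ?v] C0[of ?v] by auto
  qed
  then have "x \<bullet> (D *v y) = 0" for x y
    by (simp add: eigenbasis_form[OF basis])
  then have "D *v x = 0" for x
    using inner_eq_zero_iff by blast
  then show ?thesis
    by (simp add: matrix_eq Dx)
qed

text \<open>
  The root is the matrix that multiplies each eigenvector of \<open>A\<close> by the root of its eigenvalue.
\<close>

lemma psd_has_square_root:
  fixes A :: "real^'n^'n"
  assumes "psd A"
  shows "\<exists>B. psd B \<and> B ** B = A"
proof -
  have sym: "transpose A = A" and nonneg: "\<And>x. 0 \<le> x \<bullet> (A *v x)"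
    using assms by (auto simp: psd_def)
  obtain v d where basis: "eigenbasis A v d"
    using symmetric_has_eigenbasis[OF sym] .
  note orth = eigenbasis_inner[OF basis]
  have d: "0 \<le> d i" for i
    using nonneg[of "v i"] by (simp add: eigenbasis_mult[OF basis] orth)
  define f where "f x = (\<Sum>i\<in>UNIV. (sqrt (d i) * (v i \<bullet> x)) *\<^sub>R v i)" for x
  have "linear f"
    by (rule linearI)
      (simp_all add: f_def inner_add_right algebra_simps sum.distrib scaleR_sum_right)
  then have B: "matrix f *v x = f x" for x
    by simp
  have form: "x \<bullet> f y = (\<Sum>i\<in>UNIV. sqrt (d i) * (v i \<bullet> x) * (v i \<bullet> y))" for x y
    by (simp add: f_def inner_sum_right inner_commute mult_ac)
  have coord: "v i \<bullet> f x = sqrt (d i) * (v i \<bullet> x)" for i x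
    by (simp add: form orth mult_delta_left mult_delta_right)
  have "psd (matrix f)"
    unfolding psd_def
  proof (intro conjI allI)
    show "transpose (matrix f) = matrix f"
      by (rule symmetricI) (simp add: B form inner_commute[of "f _"] mult_ac)
    show "0 \<le> x \<bullet> (matrix f *v x)" for x
      unfolding B form using d by (intro sum_nonneg) (simp add: mult.assoc)
  qed
  moreover have "matrix f ** matrix f = A"
  proof -
    have "x \<bullet> ((matrix f ** matrix f) *v y) = x \<bullet> (A *v y)" for x y
    proof -
      have "x \<bullet> ((matrix f ** matrix f) *v y) = x \<bullet> f (f y)"
        by (simp add: matrix_vector_mul_assoc[symmetric] B)
      also have "\<dots> = (\<Sum>i\<in>UNIV. sqrt (d i) * (v i \<bullet> x) * (sqrt (d i) * (v i \<bullet> y)))"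
        unfolding form[of x "f y"] coord ..
      also have "\<dots> = (\<Sum>i\<in>UNIV. (sqrt (d i) * sqrt (d i)) * (v i \<bullet> x) * (v i \<bullet> y))"
        by (simp only: mult_ac)
      also have "\<dots> = x \<bullet> (A *v y)"
        using d by (simp add: eigenbasis_form[OF basis])
      finally show ?thesis .
    qed
    then show ?thesis
      by (metis matrix_eq vector_eq_ldot)
  qed
  ultimately show ?thesis by blast
qed

lemma mat_sqrt_psd: "psd (mat_sqrt A)" and mat_sqrt_square: "mat_sqrt A ** mat_sqrt A = A"
  if "psd A" for A :: "real^'n^'n"
proof -
  have "\<exists>!B. psd B \<and> B ** B = A"
    using psd_has_square_root[OF that] psd_square_inj by metis
  from theI'[OF this] show "psd (mat_sqrt A)" "mat_sqrt A ** mat_sqrt A = A"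
    by (auto simp: mat_sqrt_def)
qed

lemma invertible_of_ker:
  fixes A :: "real^'n^'n"
  assumes "\<And>x. A *v x = 0 \<Longrightarrow> x = 0"
  shows "invertible A"
  using assms by (simp add: invertible_left_inverse matrix_left_invertible_ker)

lemma matrix_inv_mult:
  assumes "invertible A"
  shows "A ** matrix_inv A = mat 1" and "matrix_inv A ** A = mat 1"
  using someI_ex[OF assms[unfolded invertible_def]] by (auto simp: matrix_inv_def)

lemma matrix_inv_vector:
  assumes "invertible A"
  shows "A *v (matrix_inv A *v x) = x" and "matrix_inv A *v (A *v x) = x"
  by (simp_all add: matrix_vector_mul_assoc matrix_inv_mult[OF assms])

text \<open>
  For \<open>c > 0\<close> the hypothesis says that the form of \<open>A\<^sup>-\<^sup>1\<close> is at most \<open>1/c\<close> on \<open>U\<close>, written with \<open>y = A x\<close> so that no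
  inverse occurs. With \<open>P\<close> the square root of \<open>A\<close> and \<open>z = P x\<close> it reads \<open>c (z \<bullet> z) \<le> z \<bullet> A z\<close>, where \<open>z\<close>
  runs through the preimage of \<open>U\<close> under \<open>P\<close>, which has the dimension of \<open>U\<close>.
\<close>

lemma eigval_ge_of_range_subspace:
  fixes A :: "real^'n^'n"
  assumes A: "pd A" and U: "subspace U" and k: "1 \<le> k" "k \<le> dim U"
    and ge: "\<And>x. A *v x \<in> U \<Longrightarrow> c * (x \<bullet> (A *v x)) \<le> (A *v x) \<bullet> (A *v x)"
  shows "c \<le> eigval k A"
proof -
  define P where "P = mat_sqrt A"
  have psdA: "psd A" and symA: "transpose A = A"
    using A by (auto simp: pd_imp_psd pd_def)
  have symP: "transpose P = P" and PP: "P *v (P *v x) = A *v x" for x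
    using mat_sqrt_psd[OF psdA] mat_sqrt_square[OF psdA]
    by (auto simp: psd_def P_def matrix_vector_mul_assoc)
  have "invertible P"
  proof (rule invertible_of_ker, rule ccontr)
    fix x assume "P *v x = 0" and "x \<noteq> 0"
    then have "0 < x \<bullet> (A *v x)" using A by (simp add: pd_def)
    then show False using \<open>P *v x = 0\<close> by (simp add: PP[symmetric])
  qed
  note inv = matrix_inv_vector[OF this]
  define V where "V = (*v) P -` U"
  have V: "subspace V"
    unfolding V_def by (rule linear_subspace_vimage[OF matrix_vector_mul_linear U])
  have "surj ((*v) P)"
    by (rule surjI[of _ "(*v) (matrix_inv P)"]) (rule inv(1))
  then have "(*v) P ` V = U"
    unfolding V_def by (rule surj_image_vimage_eq)
  moreover have "inj ((*v) P)"
    by (rule inj_on_inverseI[of _ "(*v) (matrix_inv P)"]) (rule inv(2))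
  then have "dim ((*v) P ` V) = dim V"
    by (intro dim_image_eq matrix_vector_mul_linear) (rule inj_on_subset, auto)
  ultimately have "dim U = dim V"
    by simp
  with k have "k \<le> dim V" by simp
  then show ?thesis
  proof (rule eigval_ge_of_subspace[OF symA V k(1)])
    fix z assume "z \<in> V"
    define x where "x = matrix_inv P *v z"
    have z: "z = P *v x"
      by (simp add: x_def inv)
    then have "A *v x \<in> U"
      using \<open>z \<in> V\<close> by (simp add: V_def PP)
    from ge[OF this] have "c * (x \<bullet> (P *v z)) \<le> (P *v z) \<bullet> (P *v z)"
      by (simp add: z PP)
    then show "c * (z \<bullet> z) \<le> z \<bullet> (A *v z)"
      using symmetric_inner[OF symP, of x z] symmetric_inner[OF symP, of z "P *v z"]
      by (simp add: PP z[symmetric])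
  qed
qed

section \<open>The scaling point\<close>

text \<open>
  Let \<open>R\<close> be the square root of \<open>P S P\<close>, so that \<open>W = P R\<^sup>-\<^sup>1 P\<close>. Then \<open>W S W = P R\<^sup>-\<^sup>1 R\<^sup>2 R\<^sup>-\<^sup>1 P = X\<close>: this is
  the property that makes \<open>W\<close> the scaling point of \<open>X\<close> and \<open>S\<close>. The bounds on \<open>P S P = R\<^sup>2\<close> give
  \<open>a R \<preceq> R\<^sup>2 \<preceq> b R\<close>, and evaluating these forms at \<open>R\<^sup>-\<^sup>1 P x\<close> compares \<open>W\<close> with \<open>X\<close>.
\<close>

lemma scaling_point:
  fixes X S W :: "real^'n^'n"
  defines "P \<equiv> mat_sqrt X"
  assumes X: "pd X" and S: "pd S" and ab: "0 < a" "0 < b"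
    and lower: "\<And>z. a\<^sup>2 * (z \<bullet> z) \<le> z \<bullet> ((P ** S ** P) *v z)"
    and upper: "\<And>z. z \<bullet> ((P ** S ** P) *v z) \<le> b\<^sup>2 * (z \<bullet> z)"
    and W: "W = P ** matrix_inv (mat_sqrt (P ** S ** P)) ** P"
  shows "pd W" and "x \<bullet> (X *v x) = (W *v x) \<bullet> (S *v (W *v x))"
    and "a * (x \<bullet> (W *v x)) \<le> x \<bullet> (X *v x)"
    and "x \<bullet> (X *v x) \<le> b * (x \<bullet> (W *v x))"
proof -
  define M where "M = P ** S ** P"
  define R where "R = mat_sqrt M"
  define N where "N = matrix_inv R"
  have psdX: "psd X" and symS: "transpose S = S"
    using X S by (auto simp: pd_imp_psd pd_def)
  have symP: "transpose P = P" and PP: "P *v (P *v x) = X *v x" for x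
    using mat_sqrt_psd[OF psdX] mat_sqrt_square[OF psdX]
    by (auto simp: psd_def P_def matrix_vector_mul_assoc)
  have Mx: "M *v x = P *v (S *v (P *v x))" for x
    by (simp add: M_def matrix_vector_mul_assoc matrix_mul_assoc)
  have symM: "transpose M = M"
    by (rule symmetricI) (simp add: Mx symmetric_inner[OF symP] symmetric_inner[OF symS])
  have psdM: "psd M"
    unfolding psd_def
  proof (intro conjI allI symM)
    fix z :: "real^'n"
    have "0 \<le> a\<^sup>2 * (z \<bullet> z)" by simp
    also have "\<dots> \<le> z \<bullet> (M *v z)" unfolding M_def by (rule lower)
    finally show "0 \<le> z \<bullet> (M *v z)" .
  qed
  have psdR: "psd R" and symR: "transpose R = R" and RR: "R *v (R *v x) = M *v x" for x
    using mat_sqrt_psd[OF psdM] mat_sqrt_square[OF psdM]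
    by (auto simp: psd_def R_def matrix_vector_mul_assoc)
  have R2: "(R *v z) \<bullet> (R *v z) = z \<bullet> (M *v z)" for z
    by (metis symmetric_inner[OF symR] RR)
  have "invertible R"
  proof (rule invertible_of_ker)
    fix z assume "R *v z = 0"
    then have "a\<^sup>2 * (z \<bullet> z) \<le> 0"
      using lower[of z] R2[of z] by (simp add: M_def)
    then have "z \<bullet> z \<le> 0"
      using ab(1) by (simp add: mult_le_0_iff)
    then show "z = 0"
      by (meson inner_gt_zero_iff not_less)
  qed
  note RN = matrix_inv_vector(1)[OF this, folded N_def] and NR = matrix_inv_vector(2)[OF this, folded N_def]
  have symN: "x \<bullet> (N *v y) = (N *v x) \<bullet> y" for x y
    using symmetric_inner[OF symR, of "N *v x" "N *v y"] by (simp add: RN)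
  have Wx: "W *v x = P *v (N *v (P *v x))" for x
    by (simp add: W N_def R_def M_def matrix_vector_mul_assoc matrix_mul_assoc)
  have WSW: "W *v (S *v (W *v x)) = X *v x" for x
  proof -
    have "W *v (S *v (W *v x)) = P *v (N *v (M *v (N *v (P *v x))))"
      by (simp add: Wx Mx)
    also have "\<dots> = X *v x"
      by (simp add: RR[symmetric] RN NR PP)
    finally show ?thesis .
  qed
  have symW: "transpose W = W"
    by (rule symmetricI) (simp add: Wx symmetric_inner[OF symP] symN)
  show "x \<bullet> (X *v x) = (W *v x) \<bullet> (S *v (W *v x))" for x
    by (simp add: WSW[of x, symmetric] symmetric_inner[OF symW])
  have form_X: "x \<bullet> (X *v x) = (R *v z) \<bullet> (R *v z)"
    and form_W: "x \<bullet> (W *v x) = z \<bullet> (R *v z)" if "z = N *v (P *v x)" for x z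
  proof -
    have "R *v z = P *v x"
      by (simp add: that RN)
    then show "x \<bullet> (X *v x) = (R *v z) \<bullet> (R *v z)"
      using symmetric_inner[OF symP, of x "P *v x"] by (simp add: PP)
    show "x \<bullet> (W *v x) = z \<bullet> (R *v z)"
      using symmetric_inner[OF symP, of x z] \<open>R *v z = P *v x\<close>
      by (simp add: Wx that inner_commute)
  qed
  show "a * (x \<bullet> (W *v x)) \<le> x \<bullet> (X *v x)" for x
    unfolding form_X[OF refl] form_W[OF refl]
    using ab lower by (intro form_le_square) (simp_all add: R2 M_def)
  show le_b: "x \<bullet> (X *v x) \<le> b * (x \<bullet> (W *v x))" for x
    unfolding form_X[OF refl] form_W[OF refl]
    using ab upper by (intro square_le_psd_form psdR) (simp_all add: R2 M_def)
  show "pd W"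
    unfolding pd_def
  proof (intro conjI allI impI symW)
    fix x :: "real^'n" assume "x \<noteq> 0"
    then have "0 < x \<bullet> (X *v x)"
      using X by (simp add: pd_def)
    then show "0 < x \<bullet> (W *v x)"
      using le_b[of x] ab(2) by (smt (verit) zero_less_mult_pos)
  qed
qed



section \<open>The eigenvalue bounds\<close>

theorem lemma3p1:
  fixes X S X_star S_star W :: "real^'n^'n"
    and \<mu> L \<delta> chi1 C1 C2 :: real
    and r :: nat
  assumes "0 < \<mu>" and "\<mu> \<le> 1" and "0 \<le> L" and "0 \<le> \<delta>" and "\<delta> < 1" and "0 < chi1"
    and "psd X_star" and "psd S_star"
    and "X_star ** S_star = 0"
    and "inverse chi1 *\<^sub>R mat 1 \<preceq> X_star + S_star" and "X_star + S_star \<preceq> mat 1"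
    and "r = rank X_star" and "1 \<le> r" and "r < CARD('n)"
    and "pd X" and "pd S"
    and "spectral_norm ((1 / \<mu>) *\<^sub>R (mat_sqrt X ** S ** mat_sqrt X) - mat 1) \<le> \<delta>"
    and "spectral_norm (X - X_star) \<le> L * \<mu>"
    and "spectral_norm (S - S_star) \<le> L"
    and "W = mat_sqrt X ** matrix_inv (mat_sqrt (mat_sqrt X ** S ** mat_sqrt X)) ** mat_sqrt X"
    and "C1 = (1 + L) / (1 - \<delta>)"
    and "C2 = 4 * chi1 + 2 * L^2 * chi1 / (1 - \<delta>)"
  shows "C1 / sqrt \<mu> \<ge> eigval 1 W \<and> eigval 1 W \<ge> eigval r W \<and> eigval r W \<ge> 1 / (C2 * sqrt \<mu>) \<and>
    C1 * sqrt \<mu> \<ge> eigval (r + 1) W \<and> eigval (r + 1) W \<ge> eigval CARD('n) W \<and>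
    eigval CARD('n) W \<ge> sqrt \<mu> / C1"
proof -
  note \<mu> = assms(1,2) and L = assms(3) and \<delta> = assms(4,5) and chi = assms(6)
  have symXs: "transpose X_star = X_star" and symSs: "transpose S_star = S_star"
    and Xs0: "0 \<le> x \<bullet> (X_star *v x)" and Ss0: "0 \<le> x \<bullet> (S_star *v x)" for x
    using assms(7,8) by (auto simp: psd_def)
  have sum_le: "x \<bullet> (X_star *v x) + x \<bullet> (S_star *v x) \<le> x \<bullet> x" for x
    using assms(11)
    by (auto simp: loewner_le_def psd_def matrix_vector_mult_diff_rdistrib
        matrix_vector_mult_add_rdistrib inner_diff_right inner_add_right)
  have sum_ge: "inverse chi1 * (x \<bullet> x) \<le> x \<bullet> (X_star *v x) + x \<bullet> (S_star *v x)" for x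
    using assms(10)
    by (auto simp: loewner_le_def psd_def matrix_vector_mult_diff_rdistrib
        matrix_vector_mult_add_rdistrib inner_diff_right inner_add_right
        scaleR_matrix_vector_assoc[symmetric])
  have X_near: "\<bar>x \<bullet> (X *v x) - x \<bullet> (X_star *v x)\<bar> \<le> L * \<mu> * (x \<bullet> x)" for x
    using spectral_norm_form[OF assms(18), of x]
    by (simp add: matrix_vector_mult_diff_rdistrib inner_diff_right)
  have S_near: "\<bar>x \<bullet> (S *v x) - x \<bullet> (S_star *v x)\<bar> \<le> L * (x \<bullet> x)" for x
    using spectral_norm_form[OF assms(19), of x]
    by (simp add: matrix_vector_mult_diff_rdistrib inner_diff_right)
  have "L * \<mu> \<le> L"
    using \<mu> L by (simp add: mult_left_le)
  then have X_le: "x \<bullet> (X *v x) \<le> (1 + L) * (x \<bullet> x)" for x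
    using X_near[of x] sum_le[of x] Ss0[of x] mult_right_mono[of "L * \<mu>" L "x \<bullet> x"]
    by (simp add: distrib_right)
  have S_le: "x \<bullet> (S *v x) \<le> (1 + L) * (x \<bullet> x)" for x
    using S_near[of x] sum_le[of x] Xs0[of x] by (simp add: distrib_right)

  \<comment> \<open>The constants are chosen so that \<open>a\<^sup>2\<close> and \<open>b\<^sup>2\<close> bound the spectrum of \<open>X\<^sup>1\<^sup>/\<^sup>2 S X\<^sup>1\<^sup>/\<^sup>2\<close>.\<close>
  define a b where "a = sqrt ((1 - \<delta>) * \<mu>)" and "b = sqrt ((1 + \<delta>) * \<mu>)"
  have ab: "0 < a" "0 < b" and ab2: "a\<^sup>2 = (1 - \<delta>) * \<mu>" "b\<^sup>2 = (1 + \<delta>) * \<mu>"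
    using \<mu> \<delta> by (simp_all add: a_def b_def)
  let ?M = "mat_sqrt X ** S ** mat_sqrt X"
  have M_near: "\<bar>z \<bullet> (?M *v z) - \<mu> * (z \<bullet> z)\<bar> \<le> \<delta> * \<mu> * (z \<bullet> z)" for z
  proof -
    have "\<bar>(z \<bullet> (?M *v z)) / \<mu> - z \<bullet> z\<bar> \<le> \<delta> * (z \<bullet> z)"
      using spectral_norm_form[OF assms(17), of z]
      by (simp add: matrix_vector_mult_diff_rdistrib inner_diff_right
          scaleR_matrix_vector_assoc[symmetric])
    then have "\<mu> * \<bar>(z \<bullet> (?M *v z)) / \<mu> - z \<bullet> z\<bar> \<le> \<mu> * (\<delta> * (z \<bullet> z))"
      using \<mu> by (intro mult_left_mono) auto
    moreover have "\<mu> * \<bar>(z \<bullet> (?M *v z)) / \<mu> - z \<bullet> z\<bar> = \<bar>z \<bullet> (?M *v z) - \<mu> * (z \<bullet> z)\<bar>"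
      using \<mu>(1) abs_mult[of \<mu> "(z \<bullet> (?M *v z)) / \<mu> - z \<bullet> z"]
      by (simp add: right_diff_distrib)
    ultimately show ?thesis by (simp add: mult_ac)
  qed
  have M_lower: "a\<^sup>2 * (z \<bullet> z) \<le> z \<bullet> (?M *v z)" and M_upper: "z \<bullet> (?M *v z) \<le> b\<^sup>2 * (z \<bullet> z)" for z
    using M_near[of z] by (simp_all add: ab2 algebra_simps abs_le_iff)
  note scaling = scaling_point[OF assms(15,16) ab M_lower M_upper assms(20)]
  have symW: "transpose W = W"
    using scaling(1) by (simp add: pd_def)
  have W_le: "x \<bullet> (W *v x) \<le> c / a * (x \<bullet> x)" if "x \<bullet> (X *v x) \<le> c * (x \<bullet> x)" for x c
    using that scaling(3)[of x] ab(1) by (simp add: field_simps)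
  have W_ge_image: "a / c * (x \<bullet> (W *v x)) \<le> (W *v x) \<bullet> (W *v x)"
    if "(W *v x) \<bullet> (S *v (W *v x)) \<le> c * ((W *v x) \<bullet> (W *v x))" "0 < c" for x c
    using that scaling(2,3)[of x] by (simp add: field_simps)

  \<comment> \<open>A number in \<open>(0, 1]\<close> such as \<open>1 - \<delta>\<close> is at most its own square root.\<close>
  have a_ge: "(1 - \<delta>) * sqrt \<mu> \<le> a"
  proof -
    have "(1 - \<delta>) * (1 - \<delta>) \<le> 1 - \<delta>"
      using \<delta> by (simp add: mult_left_le)
    then have "1 - \<delta> \<le> sqrt (1 - \<delta>)"
      by (intro real_le_rsqrt) (simp add: power2_eq_square)
    then show ?thesis
      using \<mu> by (simp add: a_def real_sqrt_mult mult_right_mono)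
  qed
  have b_le: "b \<le> 2 * sqrt \<mu>"
  proof -
    have "b \<le> sqrt (4 * \<mu>)"
      using \<mu> \<delta> by (simp add: b_def)
    then show ?thesis by (simp add: real_sqrt_mult)
  qed
  have s: "0 < sqrt \<mu>" "sqrt \<mu> * sqrt \<mu> = \<mu>" and d: "0 < 1 - \<delta>"
    using \<mu> \<delta> by simp_all
  have C2: "0 < C2" "4 * chi1 \<le> C2"
    using d chi by (simp_all add: assms(22) add_pos_nonneg)

  let ?U = "range ((*v) X_star)"
  have U: "subspace ?U" and dimU: "dim ?U = r"
    by (auto intro: linear_subspace_image subspace_UNIV simp: assms(12) rank_dim_range)
  have Ss_U: "S_star *v x = 0" if "x \<in> ?U" for x
  proof -
    have "S_star ** X_star = transpose (X_star ** S_star)"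
      by (simp add: matrix_transpose_mul symXs symSs)
    also have "\<dots> = 0"
      by (simp add: assms(9) transpose_def vec_eq_iff)
    finally show ?thesis
      using that by (auto simp: matrix_vector_mul_assoc)
  qed

  have top: "eigval 1 W \<le> C1 / sqrt \<mu>"
  proof -
    have "eigval 1 W \<le> (1 + L) / a"
      by (rule eigval_le_of_subspace[OF symW subspace_UNIV _ _ _ W_le[OF X_le]]) auto
    also have "\<dots> \<le> (1 + L) / ((1 - \<delta>) * sqrt \<mu>)"
      using a_ge L by (intro divide_left_mono mult_pos_pos ab s(1) d) auto
    finally show ?thesis
      by (simp add: assms(21))
  qed
  have small: "eigval (r + 1) W \<le> C1 * sqrt \<mu>"
  proof -
    let ?K = "{x. X_star *v x = 0}"
    have K: "subspace ?K"
      by (auto simp: subspace_def matrix_vector_right_distrib matrix_vector_mult_scaleR)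
    have dimK: "CARD('n) < dim ?K + (r + 1)"
      using dim_kernel_symmetric[OF symXs] assms(12) by simp
    have "eigval (r + 1) W \<le> L * \<mu> / a"
    proof (rule eigval_le_of_subspace[OF symW K _ _ dimK])
      fix x assume "x \<in> ?K"
      then show "x \<bullet> (W *v x) \<le> L * \<mu> / a * (x \<bullet> x)"
        using X_near[of x] by (intro W_le) simp
    qed (use assms(14) in auto)
    also have "\<dots> \<le> L * \<mu> / ((1 - \<delta>) * sqrt \<mu>)"
      using a_ge L \<mu> by (intro divide_left_mono mult_pos_pos ab s(1) d) auto
    also have "\<dots> = L / (1 - \<delta>) * sqrt \<mu>"
      using s d \<mu> real_div_sqrt[of \<mu>] by (simp add: field_simps)
    also have "\<dots> \<le> C1 * sqrt \<mu>"
      using d s by (intro mult_right_mono) (simp_all add: assms(21) divide_right_mono)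
    finally show ?thesis .
  qed
  have bottom: "sqrt \<mu> / C1 \<le> eigval CARD('n) W"
  proof -
    have "sqrt \<mu> / C1 = (1 - \<delta>) * sqrt \<mu> / (1 + L)"
      by (simp add: assms(21))
    also have "\<dots> \<le> a / (1 + L)"
      using a_ge L by (simp add: divide_right_mono)
    also have "\<dots> \<le> eigval CARD('n) W"
      by (rule eigval_ge_of_range_subspace[OF scaling(1) subspace_UNIV _ _ W_ge_image[OF S_le]])
        (use L in auto)
    finally show ?thesis .
  qed
  have large: "1 / (C2 * sqrt \<mu>) \<le> eigval r W"
  proof (cases "2 * chi1 * L * \<mu> \<le> 1")
    case True
    \<comment> \<open>The perturbation of \<open>X_star\<close> costs at most half of its lower bound \<open>1 / chi1\<close> on its range.\<close>
    have "1 / (C2 * sqrt \<mu>) \<le> 1 / (4 * chi1 * sqrt \<mu>)"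
      using C2 chi s(1) by (intro divide_left_mono mult_pos_pos mult_right_mono) auto
    also have "\<dots> \<le> 1 / (2 * chi1 * b)"
      using b_le chi s(1) by (intro divide_left_mono mult_pos_pos ab) auto
    also have "\<dots> \<le> eigval r W"
    proof (rule eigval_ge_of_subspace[OF symW U assms(13)])
      fix x assume "x \<in> ?U"
      have "1 / (2 * chi1) \<le> inverse chi1 - L * \<mu>"
        using True chi by (simp add: field_simps)
      then have "1 / (2 * chi1) * (x \<bullet> x) \<le> (inverse chi1 - L * \<mu>) * (x \<bullet> x)"
        by (intro mult_right_mono) auto
      also have "\<dots> \<le> x \<bullet> (X *v x)"
        using sum_ge[of x] X_near[of x] Ss_U[OF \<open>x \<in> ?U\<close>] by (simp add: left_diff_distrib)
      also have "\<dots> \<le> b * (x \<bullet> (W *v x))"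
        by (rule scaling(4))
      finally show "1 / (2 * chi1 * b) * (x \<bullet> x) \<le> x \<bullet> (W *v x)"
        using ab chi by (simp add: field_simps)
    qed (simp add: dimU)
    finally show ?thesis .
  next
    case False
    \<comment> \<open>The case assumption multiplied by \<open>L\<close> bounds \<open>L\<close> by a multiple of the second term of \<open>C2\<close>.\<close>
    then have Lmu: "1 < 2 * chi1 * L * \<mu>" by simp
    then have "0 < L"
      using L by (cases "L = 0") auto
    have "L \<le> 2 * L\<^sup>2 * chi1 * \<mu>"
      using mult_left_mono[of 1 "2 * chi1 * L * \<mu>" L] Lmu L by (simp add: power2_eq_square mult_ac)
    also have "\<dots> \<le> (1 - \<delta>) * C2 * \<mu>"
      using d chi \<mu> by (intro mult_right_mono) (simp_all add: assms(22) distrib_left)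
    also have "\<dots> = (1 - \<delta>) * sqrt \<mu> * (C2 * sqrt \<mu>)"
      by (subst s(2)[symmetric]) (simp only: mult_ac)
    finally have "L \<le> (1 - \<delta>) * sqrt \<mu> * (C2 * sqrt \<mu>)" .
    moreover have "0 < C2 * sqrt \<mu>"
      using C2(1) s(1) by simp
    ultimately have "1 / (C2 * sqrt \<mu>) \<le> (1 - \<delta>) * sqrt \<mu> / L"
      using \<open>0 < L\<close> by (simp add: pos_divide_le_eq pos_le_divide_eq)
    also have "\<dots> \<le> a / L"
      using a_ge L by (simp add: divide_right_mono)
    also have "\<dots> \<le> eigval r W"
    proof (rule eigval_ge_of_range_subspace[OF scaling(1) U assms(13)])
      fix x assume "W *v x \<in> ?U"
      then show "a / L * (x \<bullet> (W *v x)) \<le> (W *v x) \<bullet> (W *v x)"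
        using S_near[of "W *v x"] Ss_U \<open>0 < L\<close> by (intro W_ge_image) auto
    qed (simp add: dimU)
    finally show ?thesis .
  qed
  have "eigval r W \<le> eigval 1 W" "eigval CARD('n) W \<le> eigval (r + 1) W"
    using assms(13,14) by (auto intro!: eigval_antimono[OF symW])
  with top large small bottom show ?thesis by blast
qed

end
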